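(* Let $n\ge1$ be an integer and $\mathbb{K}$ a field of characteristic zero. Equip the algebra $C^n_{\mathbb{K}}$ of circulant $n\times n$ matrices with the Hopf algebra structure transferred from the group Hopf algebra $\mathbb{K}\mathbb{Z}_n$ via the algebra isomorphism $g:\mathbb{K}\mathbb{Z}_n\to C^n_{\mathbb{K}}$, $g(c_1e_1+\dots+c_ne_n)=\operatorname{circ}(c_1,\dots,c_n)$. Then for every circulant matrix $C=\operatorname{circ}(c_1,\dots,c_n)$, the counit $\varepsilon$, comultiplication $\Delta$ and antipode $S$ of $C^n_{\mathbb{K}}$ are given by $$\varepsilon(C)=c_1+c_2+\dots+c_n,$$ $$\Delta(C)=c_1I_n\otimes I_n+c_2P_n\otimes P_n+c_3P_n^2\otimes P_n^2+\dots+c_nP_n^{n-1}\otimes P_n^{n-1},$$ $$S(C)=C^T,$$ where $P_n=\operatorname{circ}(0,1,0,\dots,0)$ and $C^T$ is the transpose of $C$.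
   Context: $\mathbb{Z}_n$ is the cyclic group of order $n$ with elements $e_1,\dots,e_n$, where $e_i$ is the class of $i-1$, so $e_ie_j=e_{i+j-1}$ (subscripts mod $n$). $\mathbb{K}\mathbb{Z}_n$ has its usual Hopf algebra structure ($\Delta(e_i)=e_i\otimes e_i$, $\varepsilon(e_i)=1$, $S(e_i)=e_i^{-1}$). $\operatorname{circ}(c_1,\dots,c_n)$ is the $n\times n$ matrix with $(i,j)$ entry $c_{j-i+1}$ (subscripts mod $n$). The transferred structure is $\Delta=(g\otimes g)\circ\Delta_{\mathbb{K}\mathbb{Z}_n}\circ g^{-1}$, $\varepsilon=\varepsilon_{\mathbb{K}\mathbb{Z}_n}\circ g^{-1}$, $S=g\circ S_{\mathbb{K}\mathbb{Z}_n}\circ g^{-1}$. *)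

theory Defs
  imports
    "HOL-Algebra.Elementary_Groups"
    "HOL-Library.Poly_Mapping"
    "Jordan_Normal_Form.Matrix"
begin

section \<open>Tensor products\<close>

text \<open>
  Vector spaces and algebras over a field, given as a type \<open>'k\<close>, are records of type
  \<^typ>\<open>('k, 'v) module\<close>.  The free vector space on a set \<open>X\<close> consists of the
  \<open>p :: 'x \<Rightarrow>\<^sub>0 'k\<close> with \<open>Poly_Mapping.keys p \<subseteq> X\<close>; its basis vectors are the \<open>Poly_Mapping.single x 1\<close>.
\<close>

abbreviation scale :: "'k::field \<Rightarrow> ('x \<Rightarrow>\<^sub>0 'k) \<Rightarrow> 'x \<Rightarrow>\<^sub>0 'k" where
  "scale a \<equiv> Poly_Mapping.map ((*) a)"

abbreviation basis_vec :: "'x \<Rightarrow> 'x \<Rightarrow>\<^sub>0 'k::field" where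
  "basis_vec x \<equiv> Poly_Mapping.single x 1"

definition bilinear_relators ::
    "('k::field, 'v, 'a) module_scheme \<Rightarrow> ('k, 'w, 'b) module_scheme \<Rightarrow> ('v \<times> 'w \<Rightarrow>\<^sub>0 'k) set" where
  "bilinear_relators V W =
     {basis_vec (v \<oplus>\<^bsub>V\<^esub> v', w) - basis_vec (v, w) - basis_vec (v', w) | v v' w.
        v \<in> carrier V \<and> v' \<in> carrier V \<and> w \<in> carrier W} \<union>
     {basis_vec (v, w \<oplus>\<^bsub>W\<^esub> w') - basis_vec (v, w) - basis_vec (v, w') | v w w'.
        v \<in> carrier V \<and> w \<in> carrier W \<and> w' \<in> carrier W} \<union>
     {basis_vec (a \<odot>\<^bsub>V\<^esub> v, w) - scale a (basis_vec (v, w)) | a v w.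
        v \<in> carrier V \<and> w \<in> carrier W} \<union>
     {basis_vec (v, a \<odot>\<^bsub>W\<^esub> w) - scale a (basis_vec (v, w)) | a v w.
        v \<in> carrier V \<and> w \<in> carrier W}"

text \<open>
  The tensor product \<open>V \<otimes> W\<close> is the quotient of the free vector space on
  \<open>carrier V \<times> carrier W\<close> by the span of the bilinear relators; its elements are cosets.
  Operations on cosets are unions over all representatives.
\<close>

definition tensor_class ::
    "('k::field, 'v, 'a) module_scheme \<Rightarrow> ('k, 'w, 'b) module_scheme \<Rightarrow>
     ('v \<times> 'w \<Rightarrow>\<^sub>0 'k) \<Rightarrow> ('v \<times> 'w \<Rightarrow>\<^sub>0 'k) set" where
  "tensor_class V W p = (+) p ` Modules.module.span scale (bilinear_relators V W)"

definition pure_tensor ::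
    "('k::field, 'v, 'a) module_scheme \<Rightarrow> ('k, 'w, 'b) module_scheme \<Rightarrow>
     'v \<Rightarrow> 'w \<Rightarrow> ('v \<times> 'w \<Rightarrow>\<^sub>0 'k) set" where
  "pure_tensor V W v w = tensor_class V W (basis_vec (v, w))"

definition tensor_algebra ::
    "('k::field, 'v, 'a) module_scheme \<Rightarrow> ('k, 'w, 'b) module_scheme \<Rightarrow>
     ('k, ('v \<times> 'w \<Rightarrow>\<^sub>0 'k) set) module" where
  "tensor_algebra A B = \<lparr>
     carrier = tensor_class A B ` {p. Poly_Mapping.keys p \<subseteq> carrier A \<times> carrier B},
     monoid.mult = (\<lambda>X Y. \<Union>p\<in>X. \<Union>q\<in>Y. tensor_class A B
       (\<Sum>(v, w)\<in>Poly_Mapping.keys p. \<Sum>(v', w')\<in>Poly_Mapping.keys q.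
          Poly_Mapping.single (v \<otimes>\<^bsub>A\<^esub> v', w \<otimes>\<^bsub>B\<^esub> w') (Poly_Mapping.lookup p (v, w) * Poly_Mapping.lookup q (v', w')))),
     monoid.one = pure_tensor A B \<one>\<^bsub>A\<^esub> \<one>\<^bsub>B\<^esub>,
     ring.zero = tensor_class A B 0,
     ring.add = (\<lambda>X Y. \<Union>p\<in>X. \<Union>q\<in>Y. tensor_class A B (p + q)),
     smult = (\<lambda>a X. \<Union>p\<in>X. tensor_class A B (scale a p))\<rparr>"

text \<open>
  The map \<open>f \<otimes> h : V \<otimes> W \<rightarrow> V' \<otimes> W'\<close> determined by \<open>v \<otimes> w \<mapsto> f v \<otimes> h w\<close>; the union is over
  representatives of the same coset whenever \<open>f\<close> and \<open>h\<close> are linear.  The source spaces are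
  not needed, since an element of \<open>V \<otimes> W\<close> is itself a set of representatives.
\<close>

definition tensor_map ::
    "('k::field, 'v2, 'a) module_scheme \<Rightarrow> ('k, 'w2, 'b) module_scheme \<Rightarrow>
     ('v1 \<Rightarrow> 'v2) \<Rightarrow> ('w1 \<Rightarrow> 'w2) \<Rightarrow> ('v1 \<times> 'w1 \<Rightarrow>\<^sub>0 'k) set \<Rightarrow> ('v2 \<times> 'w2 \<Rightarrow>\<^sub>0 'k) set" where
  "tensor_map V' W' f h X =
     (\<Union>p\<in>X. tensor_class V' W' (\<Sum>(v, w)\<in>Poly_Mapping.keys p. Poly_Mapping.single (f v, h w) (Poly_Mapping.lookup p (v, w))))"


section \<open>Hopf algebra structures and their transfer\<close>

text \<open>The record collects the structure maps only; the Hopf algebra axioms are not part of it.\<close>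

record (overloaded) ('k::zero, 'v) hopf = "('k, 'v) module" +
  comult :: "'v \<Rightarrow> ('v \<times> 'v \<Rightarrow>\<^sub>0 'k) set"
  counit :: "'v \<Rightarrow> 'k"
  antipode :: "'v \<Rightarrow> 'v"

definition transfer_hopf ::
    "('k::field, 'v) hopf \<Rightarrow> ('v \<Rightarrow> 'w) \<Rightarrow> ('k, 'w) module \<Rightarrow> ('k, 'w) hopf" where
  "transfer_hopf H g A = module.extend A
     (hopf.fields
       (tensor_map A A g g \<circ> comult H \<circ> inv_into (carrier H) g)
       (counit H \<circ> inv_into (carrier H) g)
       (g \<circ> antipode H \<circ> inv_into (carrier H) g))"


section \<open>Group Hopf algebras\<close>

definition group_algebra :: "('g, 'm) monoid_scheme \<Rightarrow> ('k::field, 'g \<Rightarrow>\<^sub>0 'k) module" where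
  "group_algebra G = \<lparr>
     carrier = {p. Poly_Mapping.keys p \<subseteq> carrier G},
     monoid.mult = (\<lambda>p q. \<Sum>x\<in>Poly_Mapping.keys p. \<Sum>y\<in>Poly_Mapping.keys q.
       Poly_Mapping.single (x \<otimes>\<^bsub>G\<^esub> y) (Poly_Mapping.lookup p x * Poly_Mapping.lookup q y)),
     monoid.one = basis_vec \<one>\<^bsub>G\<^esub>,
     ring.zero = 0,
     ring.add = (+),
     smult = scale\<rparr>"

text \<open>
  The linear extensions of \<open>\<Delta>(x) = x \<otimes> x\<close>, \<open>\<epsilon>(x) = 1\<close>, \<open>S(x) = x\<^sup>-\<^sup>1\<close> for \<open>x \<in> G\<close>.
\<close>

definition group_hopf_algebra :: "('g, 'm) monoid_scheme \<Rightarrow> ('k::field, 'g \<Rightarrow>\<^sub>0 'k) hopf" where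
  "group_hopf_algebra G =
     (let A = group_algebra G; T = tensor_algebra A A in
      module.extend A (hopf.fields
        (\<lambda>p. \<Oplus>\<^bsub>T\<^esub>x\<in>Poly_Mapping.keys p. Poly_Mapping.lookup p x \<odot>\<^bsub>T\<^esub> pure_tensor A A (basis_vec x) (basis_vec x))
        (\<lambda>p. \<Sum>x\<in>Poly_Mapping.keys p. Poly_Mapping.lookup p x)
        (\<lambda>p. \<Sum>x\<in>Poly_Mapping.keys p. Poly_Mapping.single (inv\<^bsub>G\<^esub> x) (Poly_Mapping.lookup p x))))"


section \<open>Circulant matrices\<close>

text \<open>
  Vectors and matrices are indexed from 0: \<open>c $ k\<close> is the coefficient \<open>c\<^bsub>k+1\<^esub>\<close>, and the
  \<open>(i, j)\<close> entry (from 0) of \<open>circ(c\<^sub>1, \<dots>, c\<^sub>n)\<close> is \<open>c $ ((j - i) mod n)\<close>.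
  The summand \<open>n\<close> below keeps the subtraction on \<^typ>\<open>nat\<close> from truncating.
\<close>

definition circ :: "'k vec \<Rightarrow> 'k mat" where
  "circ c = (let n = dim_vec c in mat n n (\<lambda>(i, j). c $ ((n + j - i) mod n)))"

definition circulant_algebra :: "nat \<Rightarrow> ('k::field, 'k mat) module" where
  "circulant_algebra n = (module_mat TYPE('k) n n)\<lparr>carrier := circ ` carrier_vec n\<rparr>"

text \<open>
  \<^term>\<open>integer_mod_group n\<close> has carrier \<open>{0..<int n}\<close>, so \<open>e\<^bsub>k+1\<^esub>\<close> is \<^term>\<open>basis_vec (int k)\<close>.
\<close>

definition circ_iso :: "nat \<Rightarrow> (int \<Rightarrow>\<^sub>0 'k::field) \<Rightarrow> 'k mat" where
  "circ_iso n p = circ (vec n (\<lambda>k. Poly_Mapping.lookup p (int k)))"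

definition circulant_hopf_algebra :: "nat \<Rightarrow> ('k::field, 'k mat) hopf" where
  "circulant_hopf_algebra n =
     transfer_hopf (group_hopf_algebra (integer_mod_group n)) (circ_iso n) (circulant_algebra n)"

text \<open>
  For \<open>n = 1\<close> the tuple \<open>(0, 1, 0, \<dots>, 0)\<close> is degenerate: \<^term>\<open>unit_vec 1 1\<close> is the zero vector.
  Only the powers below \<open>n\<close> matter, and the zeroth power is the identity matrix.
\<close>

definition circ_shift :: "nat \<Rightarrow> 'k::field mat" where
  "circ_shift n = circ (unit_vec n 1)"

subsection \<open>\<^const>\<open>circ_iso\<close> is an isomorphism of algebras\<close>

lemma circ_iso_index:
  assumes "i < n" "j < n"
  shows "circ_iso n p $$ (i, j) = Poly_Mapping.lookup p ((int j - int i) mod int n)"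
proof -
  have "int ((n + j - i) mod n) = (int j - int i) mod int n"
    using assms by (simp add: of_nat_diff zmod_int)
      (metis add_diff_eq mod_add_self1)
  then show ?thesis
    using assms by (simp add: circ_iso_def circ_def Let_def)
qed

lemma circ_iso_dim: "circ_iso n p \<in> carrier_mat n n"
  by (simp add: circ_iso_def circ_def Let_def)

lemma keys_Zn:
  assumes "n \<ge> 1" "p \<in> carrier (group_algebra (integer_mod_group n))"
  shows "Poly_Mapping.keys p \<subseteq> {0..<int n}"
  using assms by (simp add: group_algebra_def carrier_integer_mod_group split: if_splits)

lemma circ_iso_bij:
  assumes n: "n \<ge> 1"
  shows "bij_betw (circ_iso n :: (int \<Rightarrow>\<^sub>0 'k::field) \<Rightarrow> _)
    (carrier (group_algebra (integer_mod_group n))) (carrier (circulant_algebra n))"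
proof (rule bij_betw_imageI)
  show "inj_on (circ_iso n :: (int \<Rightarrow>\<^sub>0 'k) \<Rightarrow> _) (carrier (group_algebra (integer_mod_group n)))"
  proof (rule inj_onI)
    fix p q :: "int \<Rightarrow>\<^sub>0 'k"
    assume p: "p \<in> carrier (group_algebra (integer_mod_group n))"
      and q: "q \<in> carrier (group_algebra (integer_mod_group n))"
      and eq: "circ_iso n p = circ_iso n q"
    have "Poly_Mapping.lookup p x = Poly_Mapping.lookup q x" for x
    proof (cases "x \<in> {0..<int n}")
      case True
      then have "Poly_Mapping.lookup p x = circ_iso n p $$ (0, nat x)"
        "Poly_Mapping.lookup q x = circ_iso n q $$ (0, nat x)"
        by (auto simp: circ_iso_index)
      with eq show ?thesis by simp
    next
      case False
      then show ?thesis using keys_Zn[OF n p] keys_Zn[OF n q]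
        by (metis in_keys_iff subsetD)
    qed
    then show "p = q" by (simp add: poly_mapping_eqI)
  qed
  show "circ_iso n ` carrier (group_algebra (integer_mod_group n)) = carrier (circulant_algebra n :: ('k, _) module)"
  proof (intro equalityI subsetI)
    fix M :: "'k mat"
    assume "M \<in> carrier (circulant_algebra n)"
    then obtain c where c: "c \<in> carrier_vec n" "M = circ c"
      by (auto simp: circulant_algebra_def)
    define p where "p = (\<Sum>k<n. Poly_Mapping.single (int k) (c $ k))"
    have l: "Poly_Mapping.lookup p (int k) = c $ k" if "k < n" for k
      using that by (simp add: p_def lookup_sum lookup_single when_def)
    have "Poly_Mapping.keys p \<subseteq> (\<Union>k<n. Poly_Mapping.keys (Poly_Mapping.single (int k) (c $ k)))"
      unfolding p_def by (rule keys_sum)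
    also have "\<dots> \<subseteq> {0..<int n}" by (auto split: if_splits)
    finally have "p \<in> carrier (group_algebra (integer_mod_group n))"
      using n by (simp add: group_algebra_def carrier_integer_mod_group)
    moreover have "vec n (\<lambda>k. Poly_Mapping.lookup p (int k)) = c"
      using c l by (intro eq_vecI) auto
    then have "M = circ_iso n p" by (simp add: circ_iso_def c)
    ultimately show "M \<in> circ_iso n ` carrier (group_algebra (integer_mod_group n))" by blast
  qed (auto simp: circulant_algebra_def circ_iso_def)
qed

lemma lookup_scale: "Poly_Mapping.lookup (scale a p) x = a * Poly_Mapping.lookup p x"
  by (simp add: Poly_Mapping.map.rep_eq when_def)

lemma circ_iso_add:
  "circ_iso n (p \<oplus>\<^bsub>group_algebra (integer_mod_group n)\<^esub> q) = circ_iso n p \<oplus>\<^bsub>circulant_algebra n\<^esub> circ_iso n q"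
  by (rule eq_matI) (use circ_iso_dim[of n p] circ_iso_dim[of n q] circ_iso_dim[of n "p+q"] in
     \<open>auto simp: group_algebra_def circulant_algebra_def module_mat_def circ_iso_index lookup_add\<close>)

lemma circ_iso_smult:
  "circ_iso n (a \<odot>\<^bsub>group_algebra (integer_mod_group n)\<^esub> p) = a \<odot>\<^bsub>circulant_algebra n\<^esub> circ_iso n p"
  by (rule eq_matI) (use circ_iso_dim[of n p] circ_iso_dim[of n "scale a p"] in
     \<open>auto simp: group_algebra_def circulant_algebra_def module_mat_def circ_iso_index lookup_scale\<close>)

lemma circ_iso_one:
  assumes "n \<ge> 1"
  shows "circ_iso n \<one>\<^bsub>group_algebra (integer_mod_group n)\<^esub> = \<one>\<^bsub>circulant_algebra n\<^esub>"
proof (rule eq_matI)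
  fix i j assume "i < dim_row \<one>\<^bsub>circulant_algebra n\<^esub>" "j < dim_col \<one>\<^bsub>circulant_algebra n\<^esub>"
  then have ij: "i < n" "j < n" by (auto simp: circulant_algebra_def module_mat_def)
  have "(int j - int i) mod int n = 0 \<longleftrightarrow> i = j"
  proof
    assume "(int j - int i) mod int n = 0"
    then have "int j mod int n = int i mod int n"
      by (simp add: mod_eq_dvd_iff dvd_eq_mod_eq_0)
    then show "i = j" using ij by simp
  qed simp
  then show "circ_iso n \<one>\<^bsub>group_algebra (integer_mod_group n)\<^esub> $$ (i, j) = \<one>\<^bsub>circulant_algebra n\<^esub> $$ (i, j)"
    using ij by (auto simp: circ_iso_index group_algebra_def circulant_algebra_def module_mat_def
      lookup_one when_def)
qed (auto simp: circ_iso_def circ_def circulant_algebra_def module_mat_def)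

lemma circ_iso_mult:
  assumes n: "n \<ge> 1"
    and p: "p \<in> carrier (group_algebra (integer_mod_group n))"
    and q: "q \<in> carrier (group_algebra (integer_mod_group n))"
  shows "circ_iso n (p \<otimes>\<^bsub>group_algebra (integer_mod_group n)\<^esub> q) =
    circ_iso n p \<otimes>\<^bsub>circulant_algebra n\<^esub> circ_iso n q"
proof -
  let ?l = "Poly_Mapping.lookup"
  define r where "r = p \<otimes>\<^bsub>group_algebra (integer_mod_group n)\<^esub> q"
  have r: "?l r z = (\<Sum>x\<in>{0..<int n}. ?l p x * ?l q ((z - x) mod int n))" if z: "z \<in> {0..<int n}" for z
  proof -
    have "?l r z = (\<Sum>x\<in>Poly_Mapping.keys p. \<Sum>y\<in>Poly_Mapping.keys q.
        if (x + y) mod int n = z then ?l p x * ?l q y else 0)"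
      by (simp add: r_def group_algebra_def lookup_sum lookup_single when_def)
    also have "\<dots> = (\<Sum>x\<in>{0..<int n}. \<Sum>y\<in>Poly_Mapping.keys q.
        if (x + y) mod int n = z then ?l p x * ?l q y else 0)"
      using keys_Zn[OF n p] by (intro sum.mono_neutral_left) (auto simp: in_keys_iff intro!: sum.neutral)
    also have "\<dots> = (\<Sum>x\<in>{0..<int n}. \<Sum>y\<in>{0..<int n}.
        if (x + y) mod int n = z then ?l p x * ?l q y else 0)"
      using keys_Zn[OF n q] by (intro sum.cong sum.mono_neutral_left refl) (auto simp: in_keys_iff)
    also have "\<dots> = (\<Sum>x\<in>{0..<int n}. \<Sum>y\<in>{0..<int n}.
        if y = (z - x) mod int n then ?l p x * ?l q y else 0)"
    proof (intro sum.cong refl)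
      fix x y assume "x \<in> {0..<int n}" and y: "y \<in> {0..<int n}"
      have "(x + y) mod int n = z \<longleftrightarrow> y = (z - x) mod int n"
      proof
        assume "(x + y) mod int n = z"
        then have "(z - x) mod int n = ((x + y) - x) mod int n" by (metis mod_diff_left_eq)
        then show "y = (z - x) mod int n" using y by simp
      next
        assume "y = (z - x) mod int n"
        then have "(x + y) mod int n = (x + (z - x)) mod int n" by (metis mod_add_right_eq)
        then show "(x + y) mod int n = z" using z by simp
      qed
      then show "(if (x + y) mod int n = z then ?l p x * ?l q y else 0) =
        (if y = (z - x) mod int n then ?l p x * ?l q y else 0)" by simp
    qed
    also have "\<dots> = (\<Sum>x\<in>{0..<int n}. ?l p x * ?l q ((z - x) mod int n))"
      using n by (intro sum.cong refl) (simp add: sum.delta)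
    finally show ?thesis .
  qed
  have "circ_iso n r = circ_iso n p * circ_iso n q"
  proof (rule eq_matI)
    fix i j assume "i < dim_row (circ_iso n p * circ_iso n q)" "j < dim_col (circ_iso n p * circ_iso n q)"
    then have ij: "i < n" "j < n" using circ_iso_dim[of n p] circ_iso_dim[of n q] by auto
    have "circ_iso n r $$ (i, j) = (\<Sum>x\<in>{0..<int n}. ?l p x * ?l q (((int j - int i) - x) mod int n))"
      using ij n r by (simp add: circ_iso_index mod_diff_left_eq)
    also have "\<dots> = (\<Sum>k\<in>{0..<n}. ?l p ((int k - int i) mod int n) * ?l q ((int j - int k) mod int n))"
    proof (rule sum.reindex_bij_witness[where j = "\<lambda>x. nat ((x + int i) mod int n)"
          and i = "\<lambda>k. (int k - int i) mod int n"])
      fix x assume x: "x \<in> {0..<int n}"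
      show "(int (nat ((x + int i) mod int n)) - int i) mod int n = x"
        using x n by (simp add: mod_diff_left_eq)
      show "nat ((x + int i) mod int n) \<in> {0..<n}" using n
        by (simp add: nat_less_iff)
      show "?l p ((int (nat ((x + int i) mod int n)) - int i) mod int n) *
         ?l q ((int j - int (nat ((x + int i) mod int n))) mod int n) =
         ?l p x * ?l q ((int j - int i - x) mod int n)"
        using x n by (simp add: mod_diff_left_eq mod_diff_right_eq algebra_simps)
    next
      fix k assume k: "k \<in> {0..<n}"
      show "nat (((int k - int i) mod int n + int i) mod int n) = k"
        using k n by (simp add: mod_add_left_eq)
      show "(int k - int i) mod int n \<in> {0..<int n}" using n by simp
    qed
    also have "\<dots> = (circ_iso n p * circ_iso n q) $$ (i, j)"
      using ij circ_iso_dim[of n p] circ_iso_dim[of n q]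
      by (simp add: scalar_prod_def circ_iso_index)
    finally show "circ_iso n r $$ (i, j) = (circ_iso n p * circ_iso n q) $$ (i, j)" .
  qed (use circ_iso_dim[of n p] circ_iso_dim[of n q] circ_iso_dim[of n r] in auto)
  then show ?thesis by (simp add: r_def circulant_algebra_def module_mat_def)
qed


end

theory Submission imports Defs begin

text \<open>
  Write a circulant matrix as \<open>C = g p\<close> with \<open>p\<close> in the group algebra of \<open>\<int>/n\<close>; the coefficient of
  \<open>p\<close> at \<open>k\<close> is then \<open>c $ k\<close> (\<open>circ_iso_preimage\<close>), and each transferred structure map at \<open>C\<close> is
  the one of the group algebra at \<open>p\<close>, pushed through \<open>g\<close>.  The counit is the sum of the
  coefficients of \<open>p\<close>.  The antipode replaces the coefficient at \<open>z\<close> by the one at \<open>-z\<close>, and since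
  the \<open>(i, j)\<close> entry of \<open>g p\<close> is the coefficient at \<open>j - i\<close>, this exchanges \<open>i\<close> and \<open>j\<close>
  (\<open>circ_iso_antipode\<close>).

  For the comultiplication, \<open>\<Delta> p\<close> is the sum of \<open>c $ k\<close> times \<open>k \<otimes> k\<close>, and \<open>g\<close> maps the basis
  vector \<open>k\<close> to the \<open>k\<close>-th power of \<open>g 1\<close>, the cyclic shift, because \<open>g\<close> is multiplicative
  (\<open>circ_iso_basis_vec\<close>).  It remains to apply \<open>g \<otimes> g\<close> under the sum.  As tensors are
  cosets in a free vector space, this is done on representatives: a finite linear combination of
  pure tensors is the coset of the corresponding combination of basis vectors
  (\<open>finsum_smult_pure_tensor\<close>), and a tensor product of linear maps acts on a coset through
  any representative (\<open>tensor_map_class\<close>), because it respects the bilinear relators.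
\<close>

section \<open>Free vector spaces\<close>

lemma module_scale: "Modules.module (scale :: 'k::field \<Rightarrow> ('x \<Rightarrow>\<^sub>0 'k) \<Rightarrow> _)"
  by unfold_locales (rule poly_mapping_eqI; simp add: lookup_scale lookup_add algebra_simps)+

lemma module_hom_scaleI:
  fixes f :: "('x \<Rightarrow>\<^sub>0 'k::field) \<Rightarrow> ('y \<Rightarrow>\<^sub>0 'k)"
  assumes "\<And>p q. f (p + q) = f p + f q" "\<And>a p. f (scale a p) = scale a (f p)"
  shows "Modules.module_hom scale scale f"
  using assms by (simp add: module_hom_iff module_scale)

lemma scale_single: "scale a (Poly_Mapping.single x b) = Poly_Mapping.single x (a * b)"
  by (rule poly_mapping_eqI) (simp add: lookup_scale lookup_single when_def)

lemma keys_scale_subset: "Poly_Mapping.keys (scale a p) \<subseteq> Poly_Mapping.keys p"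
  by (auto simp: in_keys_iff lookup_scale)

section \<open>Sums in a tensor product\<close>

lemma mem_tensor_class_iff:
  "q \<in> tensor_class V W p \<longleftrightarrow> q - p \<in> Modules.module.span scale (bilinear_relators V W)"
  unfolding tensor_class_def by (force simp: image_iff)

lemma tensor_class_refl: "p \<in> tensor_class V W p"
  by (simp add: mem_tensor_class_iff module.span_zero[OF module_scale])

lemma tensor_class_eq_iff:
  "tensor_class V W p = tensor_class V W q \<longleftrightarrow>
     p - q \<in> Modules.module.span scale (bilinear_relators V W)"
proof
  assume "tensor_class V W p = tensor_class V W q"
  then show "p - q \<in> Modules.module.span scale (bilinear_relators V W)"
    using tensor_class_refl mem_tensor_class_iff by metis
next
  assume pq: "p - q \<in> Modules.module.span scale (bilinear_relators V W)"
  have "r - p \<in> Modules.module.span scale (bilinear_relators V W) \<longleftrightarrow>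
      r - q \<in> Modules.module.span scale (bilinear_relators V W)" for r
    using module.span_add[OF module_scale _ pq, of "r - p"]
      module.span_diff[OF module_scale _ pq, of "r - q"] by auto
  then show "tensor_class V W p = tensor_class V W q"
    by (auto simp: mem_tensor_class_iff)
qed

text \<open>
  The vector space operations on tensors are unions over all representatives.  Such a union collapses
  to a single coset as soon as its members do not depend on the representative.
\<close>
lemma UN_tensor_class:
  assumes "\<And>q. q \<in> tensor_class V W p \<Longrightarrow> F q = X"
  shows "(\<Union>q\<in>tensor_class V W p. F q) = X"
  using assms tensor_class_refl[of p V W] by (intro SUP_eq_const) auto

lemma tensor_add_class:
  "tensor_class A B p \<oplus>\<^bsub>tensor_algebra A B\<^esub> tensor_class A B q = tensor_class A B (p + q)"
proof -
  have "tensor_class A B (p' + q') = tensor_class A B (p + q)"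
    if "p' \<in> tensor_class A B p" "q' \<in> tensor_class A B q" for p' q'
    using module.span_add[OF module_scale that[unfolded mem_tensor_class_iff]]
    by (simp add: tensor_class_eq_iff algebra_simps)
  then show ?thesis
    unfolding tensor_algebra_def ring.simps by (intro UN_tensor_class)
qed

lemma tensor_smult_class:
  "a \<odot>\<^bsub>tensor_algebra A B\<^esub> tensor_class A B p = tensor_class A B (scale a p)"
proof -
  have "tensor_class A B (scale a p') = tensor_class A B (scale a p)"
    if "p' \<in> tensor_class A B p" for p'
    using module.span_scale[OF module_scale that[unfolded mem_tensor_class_iff], of a]
    by (simp add: tensor_class_eq_iff module.scale_right_diff_distrib[OF module_scale])
  then show ?thesis
    unfolding tensor_algebra_def module.simps by (intro UN_tensor_class)
qed

text \<open>
  The finite sums \<open>\<Oplus>\<close> have their recursion equations only in a commutative monoid that contains the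
  summands, which is why this is needed before any such sum can be evaluated.
\<close>
lemma abelian_monoid_tensor_algebra: "abelian_monoid (tensor_algebra A B)"
proof -
  have carr: "X \<in> carrier (tensor_algebra A B) \<longleftrightarrow>
      (\<exists>p. X = tensor_class A B p \<and> Poly_Mapping.keys p \<subseteq> carrier A \<times> carrier B)" for X
    by (auto simp: tensor_algebra_def)
  have z: "\<zero>\<^bsub>tensor_algebra A B\<^esub> = tensor_class A B 0"
    by (simp add: tensor_algebra_def)
  show ?thesis
  proof (rule abelian_monoidI)
    fix X Y assume "X \<in> carrier (tensor_algebra A B)" "Y \<in> carrier (tensor_algebra A B)"
    then obtain p q where "X = tensor_class A B p" "Poly_Mapping.keys p \<subseteq> carrier A \<times> carrier B"
        "Y = tensor_class A B q" "Poly_Mapping.keys q \<subseteq> carrier A \<times> carrier B"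
      unfolding carr by blast
    moreover from this have "Poly_Mapping.keys (p + q) \<subseteq> carrier A \<times> carrier B"
      using Poly_Mapping.keys_add[of p q] by blast
    ultimately show "X \<oplus>\<^bsub>tensor_algebra A B\<^esub> Y \<in> carrier (tensor_algebra A B)"
      unfolding carr by (auto simp: tensor_add_class)
  qed (auto simp: carr z tensor_add_class add_ac intro!: exI[of _ 0])
qed

lemma finsum_tensor_class:
  assumes "finite I" "\<And>i. i \<in> I \<Longrightarrow> Poly_Mapping.keys (p i) \<subseteq> carrier A \<times> carrier B"
  shows "(\<Oplus>\<^bsub>tensor_algebra A B\<^esub>i\<in>I. tensor_class A B (p i)) = tensor_class A B (\<Sum>i\<in>I. p i)"
  using assms
proof (induction I)
  case empty
  then show ?case
    by (simp add: abelian_monoid.finsum_empty[OF abelian_monoid_tensor_algebra])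
      (simp add: tensor_algebra_def)
next
  case (insert i I)
  have "tensor_class A B (p j) \<in> carrier (tensor_algebra A B)" if "j \<in> insert i I" for j
    using insert.prems[OF that] by (auto simp: tensor_algebra_def)
  then show ?case
    using insert
    by (simp add: abelian_monoid.finsum_insert[OF abelian_monoid_tensor_algebra] tensor_add_class)
qed

lemma finsum_smult_pure_tensor:
  assumes "finite I" "\<And>i. i \<in> I \<Longrightarrow> v i \<in> carrier A" "\<And>i. i \<in> I \<Longrightarrow> w i \<in> carrier B"
  shows "(\<Oplus>\<^bsub>tensor_algebra A B\<^esub>i\<in>I. a i \<odot>\<^bsub>tensor_algebra A B\<^esub> pure_tensor A B (v i) (w i)) =
    tensor_class A B (\<Sum>i\<in>I. Poly_Mapping.single (v i, w i) (a i))"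
  using assms
  by (simp add: pure_tensor_def tensor_smult_class scale_single finsum_tensor_class)

section \<open>Tensor products of linear maps\<close>

text \<open>
  The linear map between free vector spaces that extends \<open>f\<close> on basis vectors.  For a product map
  \<open>map_prod f h\<close> it is the action of \<open>f \<otimes> h\<close> on representatives.
\<close>
definition pushforward :: "('x \<Rightarrow> 'y) \<Rightarrow> ('x \<Rightarrow>\<^sub>0 'k::field) \<Rightarrow> 'y \<Rightarrow>\<^sub>0 'k" where
  "pushforward f p = (\<Sum>x\<in>Poly_Mapping.keys p. Poly_Mapping.single (f x) (Poly_Mapping.lookup p x))"

text \<open>
  Linearity is awkward to see from a sum over the exact support, which can shrink under addition.
  A common finite superset of the supports makes the sums comparable.
\<close>
lemma pushforward_superset:
  assumes "finite S" "Poly_Mapping.keys p \<subseteq> S"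
  shows "pushforward f p = (\<Sum>x\<in>S. Poly_Mapping.single (f x) (Poly_Mapping.lookup p x))"
  unfolding pushforward_def using assms
  by (intro sum.mono_neutral_left) (auto simp: in_keys_iff)

lemma pushforward_add: "pushforward f (p + q) = pushforward f p + pushforward f q"
proof -
  let ?S = "Poly_Mapping.keys p \<union> Poly_Mapping.keys q"
  show ?thesis
    using Poly_Mapping.keys_add[of p q]
    by (simp add: pushforward_superset[of ?S] lookup_add single_add sum.distrib)
qed

lemma scale_sum: "scale a (\<Sum>i\<in>I. p i) = (\<Sum>i\<in>I. scale a (p i))"
  by (rule module.scale_sum_right[OF module_scale])

lemma pushforward_scale: "pushforward f (scale a p) = scale a (pushforward f p)"
  using keys_scale_subset[of a p]
  by (simp add: pushforward_superset[of "Poly_Mapping.keys p"] scale_sum scale_single lookup_scale)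

lemma pushforward_single: "pushforward f (Poly_Mapping.single x a) = Poly_Mapping.single (f x) a"
  by (simp add: pushforward_superset[of "{x}"])

lemma module_hom_pushforward:
  "Modules.module_hom scale scale (pushforward f :: ('x \<Rightarrow>\<^sub>0 'k::field) \<Rightarrow> _)"
  by (rule module_hom_scaleI) (simp_all add: pushforward_add pushforward_scale)

lemma pushforward_relators:
  assumes f: "f ` carrier V \<subseteq> carrier V'"
      "\<And>v v'. v \<in> carrier V \<Longrightarrow> v' \<in> carrier V \<Longrightarrow> f (v \<oplus>\<^bsub>V\<^esub> v') = f v \<oplus>\<^bsub>V'\<^esub> f v'"
      "\<And>a v. v \<in> carrier V \<Longrightarrow> f (a \<odot>\<^bsub>V\<^esub> v) = a \<odot>\<^bsub>V'\<^esub> f v"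
    and h: "h ` carrier W \<subseteq> carrier W'"
      "\<And>w w'. w \<in> carrier W \<Longrightarrow> w' \<in> carrier W \<Longrightarrow> h (w \<oplus>\<^bsub>W\<^esub> w') = h w \<oplus>\<^bsub>W'\<^esub> h w'"
      "\<And>a w. w \<in> carrier W \<Longrightarrow> h (a \<odot>\<^bsub>W\<^esub> w) = a \<odot>\<^bsub>W'\<^esub> h w"
  shows "pushforward (map_prod f h) ` bilinear_relators V W \<subseteq> bilinear_relators V' W'"
proof (rule image_subsetI)
  note hom = module_hom.diff[OF module_hom_pushforward] pushforward_scale pushforward_single
    map_prod_simp
  fix r assume "r \<in> bilinear_relators V W"
  then consider
    (add_left) v v' w where "v \<in> carrier V" "v' \<in> carrier V" "w \<in> carrier W"
      "r = basis_vec (v \<oplus>\<^bsub>V\<^esub> v', w) - basis_vec (v, w) - basis_vec (v', w)"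
  | (add_right) v w w' where "v \<in> carrier V" "w \<in> carrier W" "w' \<in> carrier W"
      "r = basis_vec (v, w \<oplus>\<^bsub>W\<^esub> w') - basis_vec (v, w) - basis_vec (v, w')"
  | (smult_left) a v w where "v \<in> carrier V" "w \<in> carrier W"
      "r = basis_vec (a \<odot>\<^bsub>V\<^esub> v, w) - scale a (basis_vec (v, w))"
  | (smult_right) a v w where "v \<in> carrier V" "w \<in> carrier W"
      "r = basis_vec (v, a \<odot>\<^bsub>W\<^esub> w) - scale a (basis_vec (v, w))"
    unfolding bilinear_relators_def by blast
  then show "pushforward (map_prod f h) r \<in> bilinear_relators V' W'"
  proof cases
    case add_left
    then have "pushforward (map_prod f h) r =
        basis_vec (f v \<oplus>\<^bsub>V'\<^esub> f v', h w) - basis_vec (f v, h w) - basis_vec (f v', h w)"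
      by (simp only: hom f(2))
    then show ?thesis
      using f(1) h(1) add_left unfolding bilinear_relators_def by blast
  next
    case add_right
    then have "pushforward (map_prod f h) r =
        basis_vec (f v, h w \<oplus>\<^bsub>W'\<^esub> h w') - basis_vec (f v, h w) - basis_vec (f v, h w')"
      by (simp only: hom h(2))
    then show ?thesis
      using f(1) h(1) add_right unfolding bilinear_relators_def by blast
  next
    case smult_left
    then have "pushforward (map_prod f h) r =
        basis_vec (a \<odot>\<^bsub>V'\<^esub> f v, h w) - scale a (basis_vec (f v, h w))"
      by (simp only: hom f(3))
    then show ?thesis
      using f(1) h(1) smult_left unfolding bilinear_relators_def by blast
  next
    case smult_right
    then have "pushforward (map_prod f h) r =
        basis_vec (f v, a \<odot>\<^bsub>W'\<^esub> h w) - scale a (basis_vec (f v, h w))"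
      by (simp only: hom h(3))
    then show ?thesis
      using f(1) h(1) smult_right unfolding bilinear_relators_def by blast
  qed
qed

text \<open>
  Well-definedness of \<open>f \<otimes> h\<close>: two representatives differ by an element of the span of the
  relators, and a linear map that takes relators to relators takes span to span.
\<close>
lemma tensor_map_class:
  assumes "f ` carrier V \<subseteq> carrier V'"
      "\<And>v v'. v \<in> carrier V \<Longrightarrow> v' \<in> carrier V \<Longrightarrow> f (v \<oplus>\<^bsub>V\<^esub> v') = f v \<oplus>\<^bsub>V'\<^esub> f v'"
      "\<And>a v. v \<in> carrier V \<Longrightarrow> f (a \<odot>\<^bsub>V\<^esub> v) = a \<odot>\<^bsub>V'\<^esub> f v"
    and "h ` carrier W \<subseteq> carrier W'"
      "\<And>w w'. w \<in> carrier W \<Longrightarrow> w' \<in> carrier W \<Longrightarrow> h (w \<oplus>\<^bsub>W\<^esub> w') = h w \<oplus>\<^bsub>W'\<^esub> h w'"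
      "\<And>a w. w \<in> carrier W \<Longrightarrow> h (a \<odot>\<^bsub>W\<^esub> w) = a \<odot>\<^bsub>W'\<^esub> h w"
  shows "tensor_map V' W' f h (tensor_class V W p) =
    tensor_class V' W' (pushforward (map_prod f h) p)"
proof -
  have "tensor_class V' W' (pushforward (map_prod f h) q) =
      tensor_class V' W' (pushforward (map_prod f h) p)" if q: "q \<in> tensor_class V W p" for q
  proof -
    have "pushforward (map_prod f h) (q - p) \<in>
        pushforward (map_prod f h) ` Modules.module.span scale (bilinear_relators V W)"
      using q by (simp add: mem_tensor_class_iff)
    also have "\<dots> \<subseteq> Modules.module.span scale (bilinear_relators V' W')"
      using module.span_mono[OF module_scale pushforward_relators[OF assms]]
      by (simp add: module_hom.span_image[OF module_hom_pushforward])
    finally show ?thesis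
      by (simp add: tensor_class_eq_iff module_hom.diff[OF module_hom_pushforward])
  qed
  moreover have "tensor_map V' W' f h X =
      (\<Union>q\<in>X. tensor_class V' W' (pushforward (map_prod f h) q))" for X
    by (simp add: tensor_map_def pushforward_def case_prod_beta' map_prod_def)
  ultimately show ?thesis
    by (simp only: UN_tensor_class)
qed

section \<open>The structure maps on circulant matrices\<close>

text \<open>
  In the group algebra the basis vector at \<open>k + 1\<close> is the product of those at \<open>k\<close> and at \<open>1\<close>.
  The step from \<open>k\<close> to \<open>k + 1 < n\<close> happens only for \<open>n \<ge> 2\<close>, where \<open>1\<close> does lie in the
  carrier \<open>{0..<n}\<close>, so the degenerate shift for \<open>n = 1\<close> never enters.
\<close>
lemma circ_iso_basis_vec:
  assumes "k < n"
  shows "circ_iso n (basis_vec (int k) :: int \<Rightarrow>\<^sub>0 'k::field) = circ_shift n ^\<^sub>m k"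
  using assms
proof (induction k)
  case 0
  then have "circ_iso n (basis_vec 0 :: int \<Rightarrow>\<^sub>0 'k) = 1\<^sub>m n"
    using circ_iso_one[of n] by (simp add: group_algebra_def circulant_algebra_def module_mat_def)
  then show ?case
    by (simp add: circ_shift_def circ_def Let_def)
next
  case (Suc k)
  let ?A = "group_algebra (integer_mod_group n) :: ('k, _) module"
  have shift: "circ_shift n = circ_iso n (basis_vec 1 :: int \<Rightarrow>\<^sub>0 'k)"
    unfolding circ_shift_def circ_iso_def
    by (rule arg_cong[where f = circ], rule eq_vecI) (auto simp: unit_vec_def lookup_single when_def)
  have "basis_vec (int (Suc k)) = basis_vec (int k) \<otimes>\<^bsub>?A\<^esub> basis_vec 1"
    using Suc.prems by (simp add: group_algebra_def add.commute)
  then have "circ_iso n (basis_vec (int (Suc k)) :: int \<Rightarrow>\<^sub>0 'k) =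
      circ_iso n (basis_vec (int k) :: int \<Rightarrow>\<^sub>0 'k) * circ_iso n (basis_vec 1)"
    using Suc.prems circ_iso_mult[of n "basis_vec (int k) :: int \<Rightarrow>\<^sub>0 'k" "basis_vec 1"]
    by (simp add: group_algebra_def circulant_algebra_def module_mat_def carrier_integer_mod_group)
  with Suc show ?case by (simp add: shift)
qed

lemma circulant_hopf_simps:
  "counit (circulant_hopf_algebra n) = (\<lambda>C. counit (group_hopf_algebra (integer_mod_group n))
     (inv_into (carrier (group_algebra (integer_mod_group n))) (circ_iso n) C))"
  "comult (circulant_hopf_algebra n) = (\<lambda>C. tensor_map (circulant_algebra n) (circulant_algebra n)
     (circ_iso n) (circ_iso n) (comult (group_hopf_algebra (integer_mod_group n))
     (inv_into (carrier (group_algebra (integer_mod_group n))) (circ_iso n) C)))"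
  "antipode (circulant_hopf_algebra n) = (\<lambda>C. circ_iso n (antipode (group_hopf_algebra (integer_mod_group n))
     (inv_into (carrier (group_algebra (integer_mod_group n))) (circ_iso n) C)))"
  by (simp_all add: circulant_hopf_algebra_def transfer_hopf_def group_hopf_algebra_def Let_def
      module.defs hopf.defs fun_eq_iff)

text \<open>
  The transferred maps start with \<open>inv_into\<close>.  Its value is recognised by its coefficients, which
  are the entries in row \<open>0\<close> of the matrix.
\<close>
lemma circ_iso_preimage:
  fixes c :: "'k::field vec"
  assumes n: "n \<ge> 1" and c: "c \<in> carrier_vec n"
  defines "p \<equiv> inv_into (carrier (group_algebra (integer_mod_group n))) (circ_iso n) (circ c)"
  shows "p \<in> carrier (group_algebra (integer_mod_group n))"
    and "circ_iso n p = circ c"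
    and "k < n \<Longrightarrow> Poly_Mapping.lookup p (int k) = c $ k"
proof -
  have "circ c \<in> carrier (circulant_algebra n)"
    using c by (simp add: circulant_algebra_def)
  then have img: "circ c \<in> circ_iso n ` carrier (group_algebra (integer_mod_group n))"
    using circ_iso_bij[OF n, where 'k = 'k] by (simp add: bij_betw_def)
  show "p \<in> carrier (group_algebra (integer_mod_group n))"
    unfolding p_def using img by (rule inv_into_into)
  show eq: "circ_iso n p = circ c"
    unfolding p_def using img by (rule f_inv_into_f)
  show "Poly_Mapping.lookup p (int k) = c $ k" if k: "k < n"
  proof -
    have "Poly_Mapping.lookup p (int k) = circ_iso n p $$ (0, k)"
      using k by (simp add: circ_iso_index)
    also have "\<dots> = c $ k"
      using k c by (simp add: eq circ_def Let_def)
    finally show ?thesis .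
  qed
qed

text \<open>
  The group algebra sums over supports, the circulant side over all indices below \<open>n\<close>; terms
  outside the support vanish.
\<close>
lemma sum_keys_Zn:
  assumes n: "n \<ge> 1" and p: "p \<in> carrier (group_algebra (integer_mod_group n))"
    and F: "\<And>x. F x 0 = 0"
  shows "(\<Sum>x\<in>Poly_Mapping.keys p. F x (Poly_Mapping.lookup p x)) =
    (\<Sum>k<n. F (int k) (Poly_Mapping.lookup p (int k)))"
proof -
  have "(\<Sum>x\<in>Poly_Mapping.keys p. F x (Poly_Mapping.lookup p x)) =
      (\<Sum>x\<in>{0..<int n}. F x (Poly_Mapping.lookup p x))"
    using keys_Zn[OF n p] F by (intro sum.mono_neutral_left) (auto simp: in_keys_iff)
  also have "{0..<int n} = int ` {..<n}"
    by (simp add: image_int_atLeastLessThan lessThan_atLeast0)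
  finally show ?thesis by (simp add: sum.reindex)
qed

lemma circ_iso_antipode:
  assumes n: "n \<ge> 1" and p: "p \<in> carrier (group_algebra (integer_mod_group n))"
  shows "circ_iso n (antipode (group_hopf_algebra (integer_mod_group n)) p) =
    transpose_mat (circ_iso n p)"
proof (rule eq_matI)
  let ?S = "antipode (group_hopf_algebra (integer_mod_group n)) p"
  have S: "Poly_Mapping.lookup ?S z = Poly_Mapping.lookup p (- z mod int n)"
    if z: "z \<in> {0..<int n}" for z
  proof -
    have "Poly_Mapping.lookup ?S z = (\<Sum>x\<in>Poly_Mapping.keys p.
        if inv\<^bsub>integer_mod_group n\<^esub> x = z then Poly_Mapping.lookup p x else 0)"
      by (simp add: group_hopf_algebra_def Let_def module.defs hopf.defs lookup_sum
          lookup_single when_def)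
    also have "\<dots> = (\<Sum>x\<in>Poly_Mapping.keys p.
        if x = - z mod int n then Poly_Mapping.lookup p x else 0)"
    proof (intro sum.cong refl if_cong)
      fix x assume "x \<in> Poly_Mapping.keys p"
      then have x: "x \<in> {0..<int n}" using keys_Zn[OF n p] by blast
      then have "inv\<^bsub>integer_mod_group n\<^esub> x = - x mod int n"
        using n by (simp add: inv_integer_mod_group carrier_integer_mod_group)
      moreover have "- x mod int n = z \<longleftrightarrow> x = - z mod int n"
        using x z by (metis add.inverse_inverse atLeastLessThan_iff mod_minus_eq mod_pos_pos_trivial)
      ultimately show "(inv\<^bsub>integer_mod_group n\<^esub> x = z) = (x = - z mod int n)" by simp
    qed
    also have "\<dots> = Poly_Mapping.lookup p (- z mod int n)"
      by (simp add: sum.delta in_keys_iff)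
    finally show ?thesis .
  qed
  fix i j assume "i < dim_row (transpose_mat (circ_iso n p))" "j < dim_col (transpose_mat (circ_iso n p))"
  then have ij: "i < n" "j < n" using circ_iso_dim[of n p] by auto
  then show "circ_iso n ?S $$ (i, j) = transpose_mat (circ_iso n p) $$ (i, j)"
    using n circ_iso_dim[of n p] by (simp add: circ_iso_index S mod_minus_eq)
qed (use circ_iso_dim[of n p] circ_iso_dim[of n "antipode (group_hopf_algebra (integer_mod_group n)) p"] in auto)

text \<open>
  The representative of \<open>\<Delta> p\<close> on which \<open>g \<otimes> g\<close> can be computed by linearity.
\<close>
lemma comult_group_hopf_algebra:
  fixes p :: "'g \<Rightarrow>\<^sub>0 'k::field"
  assumes "Poly_Mapping.keys p \<subseteq> carrier G"
  shows "comult (group_hopf_algebra G) p = tensor_class (group_algebra G) (group_algebra G)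
    (\<Sum>x\<in>Poly_Mapping.keys p. Poly_Mapping.single (basis_vec x, basis_vec x) (Poly_Mapping.lookup p x))"
proof -
  have "comult (group_hopf_algebra G) p = (\<Oplus>\<^bsub>tensor_algebra (group_algebra G) (group_algebra G)\<^esub>
      x\<in>Poly_Mapping.keys p. Poly_Mapping.lookup p x \<odot>\<^bsub>tensor_algebra (group_algebra G) (group_algebra G)\<^esub>
        pure_tensor (group_algebra G) (group_algebra G) (basis_vec x) (basis_vec x))"
    by (simp add: group_hopf_algebra_def Let_def module.defs hopf.defs)
  also have "\<dots> = tensor_class (group_algebra G) (group_algebra G)
    (\<Sum>x\<in>Poly_Mapping.keys p. Poly_Mapping.single (basis_vec x, basis_vec x) (Poly_Mapping.lookup p x))"
    using assms by (intro finsum_smult_pure_tensor) (auto simp: group_algebra_def)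
  finally show ?thesis .
qed

theorem mainTheorem6:
  fixes n :: nat and c :: "'k::field_char_0 vec"
  assumes "n \<ge> 1" and "c \<in> carrier_vec n"
  shows "counit (circulant_hopf_algebra n) (circ c) = (\<Sum>k<n. c $ k) \<and>
    comult (circulant_hopf_algebra n) (circ c) =
      (let A = circulant_algebra n; T = tensor_algebra A A in
       \<Oplus>\<^bsub>T\<^esub>k\<in>{..<n}. c $ k \<odot>\<^bsub>T\<^esub> pure_tensor A A (circ_shift n ^\<^sub>m k) (circ_shift n ^\<^sub>m k)) \<and>
    antipode (circulant_hopf_algebra n) (circ c) = transpose_mat (circ c)"
proof (intro conjI)
  let ?G = "integer_mod_group n"
  let ?K = "group_algebra ?G :: ('k, _) module"
  let ?C = "circulant_algebra n :: ('k, _) module"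
  define p where "p = inv_into (carrier ?K) (circ_iso n) (circ c)"
  note p = circ_iso_preimage[OF assms, folded p_def]
  have keys: "Poly_Mapping.keys p \<subseteq> carrier ?G"
    using p(1) by (simp add: group_algebra_def)
  have maps: "circ_iso n ` carrier ?K \<subseteq> carrier ?C"
    using circ_iso_bij[OF assms(1), where 'k = 'k] by (simp add: bij_betw_def)
  have "counit (circulant_hopf_algebra n) (circ c) =
      (\<Sum>x\<in>Poly_Mapping.keys p. Poly_Mapping.lookup p x)"
    by (simp add: circulant_hopf_simps flip: p_def)
      (simp add: group_hopf_algebra_def Let_def module.defs hopf.defs)
  also have "\<dots> = (\<Sum>k<n. c $ k)"
    using sum_keys_Zn[OF assms(1) p(1), of "\<lambda>x a. a"] p(3) by simp
  finally show "counit (circulant_hopf_algebra n) (circ c) = (\<Sum>k<n. c $ k)" .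
  show "antipode (circulant_hopf_algebra n) (circ c) = transpose_mat (circ c)"
    using circ_iso_antipode[OF assms(1) p(1)] p(2)
    by (simp add: circulant_hopf_simps flip: p_def)
  have shift_mem: "circ_shift n ^\<^sub>m k \<in> carrier ?C" if "k < n" for k
  proof -
    have "basis_vec (int k) \<in> carrier ?K"
      using that by (simp add: group_algebra_def carrier_integer_mod_group)
    with maps show ?thesis
      using circ_iso_basis_vec[OF that, where 'k = 'k] by (metis image_subset_iff)
  qed
  have "comult (circulant_hopf_algebra n) (circ c) = tensor_class ?C ?C
      (pushforward (map_prod (circ_iso n) (circ_iso n))
        (\<Sum>x\<in>Poly_Mapping.keys p. Poly_Mapping.single (basis_vec x, basis_vec x) (Poly_Mapping.lookup p x)))"
    using maps
    by (simp add: circulant_hopf_simps comult_group_hopf_algebra[OF keys] tensor_map_class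
        circ_iso_add circ_iso_smult flip: p_def)
  also have "\<dots> = tensor_class ?C ?C
      (\<Sum>x\<in>Poly_Mapping.keys p. Poly_Mapping.single
        (circ_iso n (basis_vec x :: _ \<Rightarrow>\<^sub>0 'k), circ_iso n (basis_vec x :: _ \<Rightarrow>\<^sub>0 'k)) (Poly_Mapping.lookup p x))"
    by (simp add: module_hom.sum[OF module_hom_pushforward] pushforward_single)
  also have "\<dots> = tensor_class ?C ?C
      (\<Sum>k<n. Poly_Mapping.single (circ_shift n ^\<^sub>m k, circ_shift n ^\<^sub>m k) (c $ k))"
    by (subst sum_keys_Zn[OF assms(1) p(1)]) (simp_all add: p(3) circ_iso_basis_vec)
  also have "\<dots> = (\<Oplus>\<^bsub>tensor_algebra ?C ?C\<^esub>k\<in>{..<n}. c $ k \<odot>\<^bsub>tensor_algebra ?C ?C\<^esub>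
      pure_tensor ?C ?C (circ_shift n ^\<^sub>m k) (circ_shift n ^\<^sub>m k))"
    using shift_mem by (intro finsum_smult_pure_tensor[symmetric]) auto
  finally show "comult (circulant_hopf_algebra n) (circ c) =
      (let A = circulant_algebra n; T = tensor_algebra A A in
       \<Oplus>\<^bsub>T\<^esub>k\<in>{..<n}. c $ k \<odot>\<^bsub>T\<^esub> pure_tensor A A (circ_shift n ^\<^sub>m k) (circ_shift n ^\<^sub>m k))"
    by (simp add: Let_def)
qed

end
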